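(* Let $\alpha,\beta\in\mathbb{R}$ with $\alpha\neq 0$, and let $(G_1,g,J)$ be the connected, simply connected three-dimensional Lie group with left-invariant Lorentzian metric $g$ whose Lie algebra $\mathfrak{g}$ has a pseudo-orthonormal basis $\{e_1,e_2,e_3\}$ with $e_3$ timelike such that $$[e_1,e_2]=\alpha e_1-\beta e_3,\quad [e_1,e_3]=-\alpha e_1-\beta e_2,\quad [e_2,e_3]=\beta e_1+\alpha e_2+\alpha e_3,$$ equipped with the product structure $Je_1=e_1$, $Je_2=e_2$, $Je_3=-e_3$. Then $(G_1,g,J)$ is not a second kind algebraic Wanas soliton associated to the canonical connection $\nabla^0$; that is, there are no real number $c$ and derivation $D$ of $\mathfrak{g}$ with $\widetilde{\mathrm{Wan}}^0=c\,\mathrm{Id}+D$.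
   Context: Pseudo-orthonormal with $e_3$ timelike means $g(e_1,e_1)=g(e_2,e_2)=1$, $g(e_3,e_3)=-1$, $g(e_i,e_j)=0$ for $i\ne j$. All tensors are left-invariant and evaluated on the Lie algebra $\mathfrak{g}$ of left-invariant vector fields. Let $\nabla$ be the Levi-Civita connection of $g$, and let $J$ be the product structure given in the claim, with $(\nabla_XJ)Y=\nabla_X(JY)-J(\nabla_XY)$. Canonical connection: $\nabla^0_XY=\nabla_XY-\frac12(\nabla_XJ)JY$. Curvature: $R^0(X,Y)Z=\nabla^0_X\nabla^0_YZ-\nabla^0_Y\nabla^0_XZ-\nabla^0_{[X,Y]}Z$. Torsion: $T^0(X,Y)=\nabla^0_XY-\nabla^0_YX-[X,Y]$. $A^0(X,Y)Z=T^0(T^0(X,Y),Z)$, and the Wanas tensor is $W^0(X,Y)Z=R^0(X,Y)Z-A^0(X,Y)Z$. $w^0(X,Y)=-g(W^0(X,e_1)Y,e_1)-g(W^0(X,e_2)Y,e_2)+g(W^0(X,e_3)Y,e_3)$. $\widetilde w^0(X,Y)=\frac12\big(w^0(X,Y)+w^0(Y,X)\big)$, and the operator $\widetilde{\mathrm{Wan}}^0:\mathfrak g\to\mathfrak g$ is defined by $\widetilde w^0(X,Y)=g(\widetilde{\mathrm{Wan}}^0(X),Y)$. A derivation of $\mathfrak g$ is a linear map $D$ with $D[X,Y]=[DX,Y]+[X,DY]$ for all $X,Y\in\mathfrak g$. $(G_1,g,J)$ is a second kind algebraic Wanas soliton associated to $\nabla^0$ if $\widetilde{\mathrm{Wan}}^0=c\,\mathrm{Id}+D$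 for a real number $c$ and a derivation $D$ of $\mathfrak g$. *)

theory Defs
  imports "HOL-Analysis.Analysis"
begin

text \<open>
  A left-invariant tensor or connection on a Lie group is determined by its values on the Lie
  algebra of left-invariant vector fields. A Lie group with a left-invariant metric and
  (1,1)-tensor \<open>J\<close> is therefore given here by a real vector space \<open>'a\<close> with a bracket \<open>br\<close>,
  a bilinear form \<open>g\<close> and a linear map \<open>J\<close>.
\<close>

definition lie_bracket :: "('a::real_vector \<Rightarrow> 'a \<Rightarrow> 'a) \<Rightarrow> bool" where
  "lie_bracket br \<longleftrightarrow> bilinear br \<and> (\<forall>x. br x x = 0) \<and>
     (\<forall>x y z. br x (br y z) + br y (br z x) + br z (br x y) = 0)"

definition derivation :: "('a::real_vector \<Rightarrow> 'a \<Rightarrow> 'a) \<Rightarrow> ('a \<Rightarrow> 'a) \<Rightarrow> bool" where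
  "derivation br D \<longleftrightarrow> linear D \<and> (\<forall>x y. D (br x y) = br (D x) y + br x (D y))"

definition symmetric_bilinear_form :: "('a::real_vector \<Rightarrow> 'a \<Rightarrow> real) \<Rightarrow> bool" where
  "symmetric_bilinear_form g \<longleftrightarrow> bilinear g \<and> (\<forall>x y. g x y = g y x)"

definition basis3 :: "'a::real_vector \<Rightarrow> 'a \<Rightarrow> 'a \<Rightarrow> bool" where
  "basis3 e1 e2 e3 \<longleftrightarrow> distinct [e1, e2, e3] \<and> independent {e1, e2, e3} \<and> span {e1, e2, e3} = UNIV"

text \<open>The vector \<open>e3\<close> is timelike; a symmetric bilinear form admitting such a basis has
  signature (2,1), i.e. it is Lorentzian.\<close>

definition pseudo_orthonormal_basis ::
    "('a::real_vector \<Rightarrow> 'a \<Rightarrow> real) \<Rightarrow> 'a \<Rightarrow> 'a \<Rightarrow> 'a \<Rightarrow> bool" where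
  "pseudo_orthonormal_basis g e1 e2 e3 \<longleftrightarrow> basis3 e1 e2 e3 \<and>
     g e1 e1 = 1 \<and> g e2 e2 = 1 \<and> g e3 e3 = -1 \<and>
     g e1 e2 = 0 \<and> g e1 e3 = 0 \<and> g e2 e3 = 0"

text \<open>On left-invariant fields the functions \<open>g y z\<close> are constant, so the term \<open>x (g y z)\<close> of
  the metric compatibility condition vanishes.\<close>

definition is_levi_civita ::
    "('a::real_vector \<Rightarrow> 'a \<Rightarrow> 'a) \<Rightarrow> ('a \<Rightarrow> 'a \<Rightarrow> real) \<Rightarrow> ('a \<Rightarrow> 'a \<Rightarrow> 'a) \<Rightarrow> bool" where
  "is_levi_civita br g nab \<longleftrightarrow> bilinear nab \<and>
     (\<forall>x y. nab x y - nab y x = br x y) \<and>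
     (\<forall>x y z. g (nab x y) z + g y (nab x z) = 0)"

text \<open>Existence and uniqueness hold whenever \<open>g\<close> is nondegenerate and \<open>'a\<close> is
  finite-dimensional (Koszul formula).\<close>

definition levi_civita ::
    "('a::real_vector \<Rightarrow> 'a \<Rightarrow> 'a) \<Rightarrow> ('a \<Rightarrow> 'a \<Rightarrow> real) \<Rightarrow> 'a \<Rightarrow> 'a \<Rightarrow> 'a" where
  "levi_civita br g = (THE nab. is_levi_civita br g nab)"

definition nabla_J ::
    "('a::real_vector \<Rightarrow> 'a \<Rightarrow> 'a) \<Rightarrow> ('a \<Rightarrow> 'a \<Rightarrow> real) \<Rightarrow> ('a \<Rightarrow> 'a) \<Rightarrow> 'a \<Rightarrow> 'a \<Rightarrow> 'a" where
  "nabla_J br g J x y = levi_civita br g x (J y) - J (levi_civita br g x y)"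

definition canonical_connection ::
    "('a::real_vector \<Rightarrow> 'a \<Rightarrow> 'a) \<Rightarrow> ('a \<Rightarrow> 'a \<Rightarrow> real) \<Rightarrow> ('a \<Rightarrow> 'a) \<Rightarrow> 'a \<Rightarrow> 'a \<Rightarrow> 'a" where
  "canonical_connection br g J x y = levi_civita br g x y - (1/2) *\<^sub>R nabla_J br g J x (J y)"

definition curvature ::
    "('a::real_vector \<Rightarrow> 'a \<Rightarrow> 'a) \<Rightarrow> ('a \<Rightarrow> 'a \<Rightarrow> 'a) \<Rightarrow> 'a \<Rightarrow> 'a \<Rightarrow> 'a \<Rightarrow> 'a" where
  "curvature br nab x y z = nab x (nab y z) - nab y (nab x z) - nab (br x y) z"

definition torsion ::
    "('a::real_vector \<Rightarrow> 'a \<Rightarrow> 'a) \<Rightarrow> ('a \<Rightarrow> 'a \<Rightarrow> 'a) \<Rightarrow> 'a \<Rightarrow> 'a \<Rightarrow> 'a" where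
  "torsion br nab x y = nab x y - nab y x - br x y"

definition wanas_tensor ::
    "('a::real_vector \<Rightarrow> 'a \<Rightarrow> 'a) \<Rightarrow> ('a \<Rightarrow> 'a \<Rightarrow> 'a) \<Rightarrow> 'a \<Rightarrow> 'a \<Rightarrow> 'a \<Rightarrow> 'a" where
  "wanas_tensor br nab x y z =
     curvature br nab x y z - torsion br nab (torsion br nab x y) z"

definition wanas_form ::
    "('a::real_vector \<Rightarrow> 'a \<Rightarrow> 'a) \<Rightarrow> ('a \<Rightarrow> 'a \<Rightarrow> real) \<Rightarrow> ('a \<Rightarrow> 'a) \<Rightarrow> 'a \<Rightarrow> 'a \<Rightarrow> 'a \<Rightarrow>
     'a \<Rightarrow> 'a \<Rightarrow> real" where
  "wanas_form br g J e1 e2 e3 x y =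
     (let W = wanas_tensor br (canonical_connection br g J)
      in - g (W x e1 y) e1 - g (W x e2 y) e2 + g (W x e3 y) e3)"

definition sym_wanas_form ::
    "('a::real_vector \<Rightarrow> 'a \<Rightarrow> 'a) \<Rightarrow> ('a \<Rightarrow> 'a \<Rightarrow> real) \<Rightarrow> ('a \<Rightarrow> 'a) \<Rightarrow> 'a \<Rightarrow> 'a \<Rightarrow> 'a \<Rightarrow>
     'a \<Rightarrow> 'a \<Rightarrow> real" where
  "sym_wanas_form br g J e1 e2 e3 x y =
     (1/2) * (wanas_form br g J e1 e2 e3 x y + wanas_form br g J e1 e2 e3 y x)"

text \<open>The operator is uniquely determined, and linear, when \<open>g\<close> is nondegenerate and \<open>'a\<close>
  is finite-dimensional.\<close>

definition sym_wanas_operator ::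
    "('a::real_vector \<Rightarrow> 'a \<Rightarrow> 'a) \<Rightarrow> ('a \<Rightarrow> 'a \<Rightarrow> real) \<Rightarrow> ('a \<Rightarrow> 'a) \<Rightarrow> 'a \<Rightarrow> 'a \<Rightarrow> 'a \<Rightarrow>
     'a \<Rightarrow> 'a" where
  "sym_wanas_operator br g J e1 e2 e3 =
     (THE Wan. \<forall>x y. sym_wanas_form br g J e1 e2 e3 x y = g (Wan x) y)"

definition second_kind_algebraic_wanas_soliton ::
    "('a::real_vector \<Rightarrow> 'a \<Rightarrow> 'a) \<Rightarrow> ('a \<Rightarrow> 'a \<Rightarrow> real) \<Rightarrow> ('a \<Rightarrow> 'a) \<Rightarrow> 'a \<Rightarrow> 'a \<Rightarrow> 'a \<Rightarrow>
     bool" where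
  "second_kind_algebraic_wanas_soliton br g J e1 e2 e3 \<longleftrightarrow>
     (\<exists>(c::real) D. derivation br D \<and>
        (\<forall>x. sym_wanas_operator br g J e1 e2 e3 x = c *\<^sub>R x + D x))"

end

theory Submission
  imports Defs
begin

text \<open>
  The canonical connection is the part of the Levi-Civita connection that commutes with \<open>J\<close>. Since
  \<open>J\<close> splits off \<open>e3\<close>, it annihilates \<open>e3\<close> and rotates the plane of \<open>e1\<close> and \<open>e2\<close>, so that it is
  determined by a single linear form, which the Koszul formula provides. This makes the symmetrized
  Wanas operator explicit. If it were \<open>c Id + D\<close> with a derivation \<open>D\<close>, the derivation identity for
  \<open>[e1, e2]\<close> would give \<open>\<beta> = 0\<close> (from the component along \<open>e2\<close>) and the value of \<open>c\<close> (from the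
  component along \<open>e1\<close>); the identity for \<open>[e1, e3]\<close> then forces \<open>\<alpha> = 0\<close>.
\<close>

section \<open>Lorentzian frames and the Levi-Civita connection\<close>

lemmas bilinear_simps =
  bilinear_ladd bilinear_radd bilinear_lmul bilinear_rmul bilinear_lneg bilinear_rneg
  bilinear_lsub bilinear_rsub bilinear_lzero bilinear_rzero

lemma lie_bracket_antisym:
  assumes "lie_bracket br"
  shows "br y x = - br x y"
proof -
  have b: "bilinear br" and alt: "\<And>x. br x x = 0"
    using assms by (auto simp: lie_bracket_def)
  have "br (x + y) (x + y) = br x x + br y x + (br x y + br y y)"
    by (simp only: bilinear_ladd[OF b] bilinear_radd[OF b])
  then show ?thesis
    by (simp add: alt eq_neg_iff_add_eq_0)
qed

text \<open>The right-hand side of the Koszul formula, already halved; its derivative terms vanish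
  on left-invariant fields.\<close>

definition koszul ::
    "('a::real_vector \<Rightarrow> 'a \<Rightarrow> 'a) \<Rightarrow> ('a \<Rightarrow> 'a \<Rightarrow> real) \<Rightarrow> 'a \<Rightarrow> 'a \<Rightarrow> 'a \<Rightarrow> real" where
  "koszul br g x y z = (g (br x y) z - g (br y z) x + g (br z x) y) / 2"

locale lorentzian_frame =
  fixes g :: "'a::real_vector \<Rightarrow> 'a \<Rightarrow> real" and e1 e2 e3 :: 'a
  assumes form: "symmetric_bilinear_form g"
    and frame: "pseudo_orthonormal_basis g e1 e2 e3"
begin

lemma bilinear_g: "bilinear g" and g_sym: "g x y = g y x"
  using form by (auto simp: symmetric_bilinear_form_def)

lemmas g_simps = bilinear_simps[OF bilinear_g]

lemma g_frame [simp]: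
  "g e1 e1 = 1" "g e2 e2 = 1" "g e3 e3 = - 1" "g e1 e2 = 0" "g e1 e3 = 0" "g e2 e3 = 0"
  "g e2 e1 = 0" "g e3 e1 = 0" "g e3 e2 = 0"
  using frame g_sym by (auto simp: pseudo_orthonormal_basis_def)

text \<open>The coefficient along \<open>e3\<close> carries a minus sign because \<open>e3\<close>
  is timelike.\<close>

lemma frame_expansion: "x = g x e1 *\<^sub>R e1 + g x e2 *\<^sub>R e2 - g x e3 *\<^sub>R e3"
proof -
  have "x \<in> span {e1, e2, e3}"
    using frame by (auto simp: pseudo_orthonormal_basis_def basis3_def)
  then obtain a b c where "x - a *\<^sub>R e1 - b *\<^sub>R e2 = c *\<^sub>R e3"
    by (auto simp: span_insert span_singleton)
  then have x: "x = a *\<^sub>R e1 + b *\<^sub>R e2 + c *\<^sub>R e3"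
    by (simp add: algebra_simps)
  show ?thesis
    unfolding x by (simp add: g_simps)
qed

lemma g_nondegenerate:
  assumes "\<And>z. g x z = g y z"
  shows "x = y"
  by (subst (1 2) frame_expansion) (simp add: assms)

lemma linear_functional_represented:
  assumes "linear f"
  shows "g (f e1 *\<^sub>R e1 + f e2 *\<^sub>R e2 - f e3 *\<^sub>R e3) z = f z"
proof -
  have "f z = f (g z e1 *\<^sub>R e1 + g z e2 *\<^sub>R e2 - g z e3 *\<^sub>R e3)"
    using frame_expansion[of z] by simp
  then show ?thesis
    using g_sym[of z] assms by (simp add: g_simps linear_add linear_diff linear_scale mult.commute)
qed

lemma is_levi_civita_koszul:
  assumes lc: "is_levi_civita br g nab"
  shows "g (nab x y) z = koszul br g x y z"
proof -
  have t: "br u v = nab u v - nab v u" for u v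
    using lc by (simp add: is_levi_civita_def)
  have "g (nab u v) w + g v (nab u w) = 0" for u v w
    using lc by (simp add: is_levi_civita_def)
  then have m: "g (nab u v) w = - g (nab u w) v" for u v w
    by (metis g_sym eq_neg_iff_add_eq_0)
  show ?thesis
    unfolding koszul_def t
    \<comment> \<open>Torsion-freeness has produced six connection terms. Skewness cancels the pairs
      differentiating along \<open>y\<close> and along \<open>z\<close>, and doubles
      \<open>g (nab x y) z\<close>.\<close>
    using m[of x y z] m[of y x z] m[of z x y] by (simp add: g_simps)
qed

lemma levi_civita_exists:
  assumes br: "lie_bracket br"
  shows "\<exists>nab. is_levi_civita br g nab"
proof -
  have b: "bilinear br"
    using br by (simp add: lie_bracket_def)
  note s = bilinear_simps[OF b] g_simps
  let ?K = "koszul br g"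
  \<comment> \<open>The vector dual to the linear form \<open>?K x y\<close>, so that the Koszul
    formula holds by construction.\<close>
  define nab where "nab x y = ?K x y e1 *\<^sub>R e1 + ?K x y e2 *\<^sub>R e2 - ?K x y e3 *\<^sub>R e3" for x y
  have "linear (?K x y)" for x y
    by (rule linearI) (simp_all add: koszul_def s field_simps)
  then have g_nab: "g (nab x y) z = ?K x y z" for x y z
    unfolding nab_def by (rule linear_functional_represented)
  have nab: "bilinear nab"
    unfolding bilinear_def
    by (auto intro!: linearI g_nondegenerate simp: g_simps g_nab)
      (simp_all add: koszul_def s field_simps)
  have neg: "g (br v u) w = - g (br u v) w" for u v w
    by (subst lie_bracket_antisym[OF br]) (simp add: g_simps)
  have "nab x y - nab y x = br x y" for x y
  proof (rule g_nondegenerate)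
    fix z
    show "g (nab x y - nab y x) z = g (br x y) z"
      using neg[of x y z] neg[of x z y] neg[of y z x]
      by (simp add: g_nab g_simps koszul_def field_simps)
  qed
  moreover have "g (nab x y) z + g y (nab x z) = 0" for x y z
    using neg[of x y z] neg[of x z y] neg[of y z x]
    by (simp add: g_nab g_sym[of y] koszul_def field_simps)
  ultimately show ?thesis
    using nab unfolding is_levi_civita_def by blast
qed

text \<open>Resolves the definite description: the Koszul formula fixes all pairings with
  \<open>nab x y\<close>, and \<open>g\<close> is nondegenerate.\<close>

lemma is_levi_civita_levi_civita:
  assumes br: "lie_bracket br"
  shows "is_levi_civita br g (levi_civita br g)"
proof -
  obtain nab where nab: "is_levi_civita br g nab"
    using levi_civita_exists[OF br] ..
  have "nab' = nab" if "is_levi_civita br g nab'" for nab'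
    by (intro ext g_nondegenerate)
      (simp add: is_levi_civita_koszul[OF nab] is_levi_civita_koszul[OF that])
  with nab show ?thesis
    unfolding levi_civita_def by (metis theI)
qed

lemma koszul_formula:
  assumes "lie_bracket br"
  shows "g (levi_civita br g x y) z = koszul br g x y z"
  using assms by (intro is_levi_civita_koszul is_levi_civita_levi_civita)

end

section \<open>The given Lie algebra, its canonical connection and torsion\<close>

locale wanas_G1 = lorentzian_frame g e1 e2 e3
  for g :: "'a::real_vector \<Rightarrow> 'a \<Rightarrow> real" and e1 e2 e3 :: 'a +
  fixes \<alpha> \<beta> :: real and br :: "'a \<Rightarrow> 'a \<Rightarrow> 'a" and J :: "'a \<Rightarrow> 'a"
  assumes lie: "lie_bracket br"
    and br12: "br e1 e2 = \<alpha> *\<^sub>R e1 - \<beta> *\<^sub>R e3"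
    and br13: "br e1 e3 = - (\<alpha> *\<^sub>R e1) - \<beta> *\<^sub>R e2"
    and br23: "br e2 e3 = \<beta> *\<^sub>R e1 + \<alpha> *\<^sub>R e2 + \<alpha> *\<^sub>R e3"
    and linear_J: "linear J"
    and J_frame [simp]: "J e1 = e1" "J e2 = e2" "J e3 = - e3"
begin

lemma bilinear_br: "bilinear br"
  using lie by (simp add: lie_bracket_def)

lemmas br_simps = bilinear_simps[OF bilinear_br]

lemma br_frame [simp]:
  "br e1 e1 = 0" "br e2 e2 = 0" "br e3 e3 = 0"
  "br e1 e2 = \<alpha> *\<^sub>R e1 - \<beta> *\<^sub>R e3" "br e2 e1 = \<beta> *\<^sub>R e3 - \<alpha> *\<^sub>R e1"
  "br e1 e3 = - (\<alpha> *\<^sub>R e1) - \<beta> *\<^sub>R e2" "br e3 e1 = \<alpha> *\<^sub>R e1 + \<beta> *\<^sub>R e2"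
  "br e2 e3 = \<beta> *\<^sub>R e1 + \<alpha> *\<^sub>R e2 + \<alpha> *\<^sub>R e3"
  "br e3 e2 = - (\<beta> *\<^sub>R e1) - \<alpha> *\<^sub>R e2 - \<alpha> *\<^sub>R e3"
  using lie lie_bracket_antisym[OF lie, of e2 e1] lie_bracket_antisym[OF lie, of e3 e1]
    lie_bracket_antisym[OF lie, of e3 e2]
  by (simp_all add: lie_bracket_def br12 br13 br23)

abbreviation nab0 :: "'a \<Rightarrow> 'a \<Rightarrow> 'a" where
  "nab0 \<equiv> canonical_connection br g J"

lemma bilinear_nab0: "bilinear nab0"
proof -
  have "bilinear (levi_civita br g)"
    using is_levi_civita_levi_civita[OF lie] by (simp add: is_levi_civita_def)
  note s = bilinear_simps[OF this] linear_add[OF linear_J] linear_scale[OF linear_J]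
  show ?thesis
    unfolding bilinear_def canonical_connection_def nabla_J_def
    by (auto intro!: linearI simp: s algebra_simps)
qed

lemmas nab0_simps = bilinear_simps[OF bilinear_nab0]

text \<open>As \<open>J\<close> squares to the identity, \<open>nab0 x y\<close> is half the sum of
  \<open>levi_civita br g x y\<close> and \<open>J (levi_civita br g x (J y))\<close>. For
  \<open>y\<close> in the frame this projects the first term onto the eigenspace of \<open>J\<close>
  containing \<open>y\<close>.\<close>

lemma nab0_frame:
  "nab0 x e1 = koszul br g x e1 e2 *\<^sub>R e2"
  "nab0 x e2 = koszul br g x e2 e1 *\<^sub>R e1"
  "nab0 x e3 = 0"
proof -
  have lc: "levi_civita br g x y =
      koszul br g x y e1 *\<^sub>R e1 + koszul br g x y e2 *\<^sub>R e2 - koszul br g x y e3 *\<^sub>R e3" for y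
    using frame_expansion[of "levi_civita br g x y"] by (simp add: koszul_formula[OF lie])
  have "bilinear (levi_civita br g)"
    using is_levi_civita_levi_civita[OF lie] by (simp add: is_levi_civita_def)
  note neg = bilinear_rneg[OF this]
  \<comment> \<open>Metric compatibility: the covariant derivative of \<open>y\<close> is orthogonal
    to \<open>y\<close>. This leaves one component for \<open>e1\<close> and for \<open>e2\<close>,
    and none for \<open>e3\<close>.\<close>
  have "koszul br g x y y = 0" for y
    using lie lie_bracket_antisym[OF lie, of x y] by (simp add: koszul_def lie_bracket_def g_simps)
  then show "nab0 x e1 = koszul br g x e1 e2 *\<^sub>R e2"
    "nab0 x e2 = koszul br g x e2 e1 *\<^sub>R e1"
    "nab0 x e3 = 0"
    by - (rule g_nondegenerate, simp add: canonical_connection_def nabla_J_def neg lc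
        linear_add[OF linear_J] linear_diff[OF linear_J] linear_scale[OF linear_J]
        linear_neg[OF linear_J] g_simps)+
qed

lemma nab0_table [simp]:
  "nab0 e1 e1 = - (\<alpha> *\<^sub>R e2)" "nab0 e1 e2 = \<alpha> *\<^sub>R e1" "nab0 x e3 = 0"
  "nab0 e2 e1 = 0" "nab0 e2 e2 = 0"
  "nab0 e3 e1 = (\<beta> / 2) *\<^sub>R e2" "nab0 e3 e2 = - ((\<beta> / 2) *\<^sub>R e1)"
  by (simp_all add: nab0_frame koszul_def g_simps)

lemma bilinear_torsion: "bilinear (torsion br nab0)"
  unfolding bilinear_def torsion_def
  by (auto intro!: linearI simp: br_simps nab0_simps algebra_simps)

lemmas torsion_simps = bilinear_simps[OF bilinear_torsion]

lemma torsion_table [simp]: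
  "torsion br nab0 e1 e1 = 0" "torsion br nab0 e2 e2 = 0" "torsion br nab0 e3 e3 = 0"
  "torsion br nab0 e1 e2 = \<beta> *\<^sub>R e3" "torsion br nab0 e2 e1 = - (\<beta> *\<^sub>R e3)"
  "torsion br nab0 e1 e3 = \<alpha> *\<^sub>R e1 + (\<beta> / 2) *\<^sub>R e2"
  "torsion br nab0 e3 e1 = - (\<alpha> *\<^sub>R e1) - (\<beta> / 2) *\<^sub>R e2"
  "torsion br nab0 e2 e3 = - ((\<beta> / 2) *\<^sub>R e1) - \<alpha> *\<^sub>R e2 - \<alpha> *\<^sub>R e3"
  "torsion br nab0 e3 e2 = (\<beta> / 2) *\<^sub>R e1 + \<alpha> *\<^sub>R e2 + \<alpha> *\<^sub>R e3"
  \<comment> \<open>Pairing with an arbitrary vector turns each vector identity into real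
    arithmetic.\<close>
  by (rule g_nondegenerate, simp add: torsion_def g_simps field_simps)+

section \<open>The symmetrized Wanas form and its operator\<close>

lemma linear_wanas_form:
  "linear (\<lambda>x. wanas_form br g J e1 e2 e3 x y)" "linear (wanas_form br g J e1 e2 e3 x)"
  unfolding wanas_form_def wanas_tensor_def curvature_def Let_def
  by (rule linearI; simp add: br_simps nab0_simps torsion_simps g_simps algebra_simps)+

abbreviation w :: "'a \<Rightarrow> 'a \<Rightarrow> real" where
  "w \<equiv> sym_wanas_form br g J e1 e2 e3"

lemma bilinear_w: "bilinear w"
  unfolding bilinear_def sym_wanas_form_def
  by (auto intro!: linearI simp: linear_add[OF linear_wanas_form(1)]
      linear_add[OF linear_wanas_form(2)] linear_scale[OF linear_wanas_form(1)]
      linear_scale[OF linear_wanas_form(2)] field_simps)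

lemma w_table:
  "w e1 e1 = - \<alpha>\<^sup>2 - 3 / 2 * \<beta>\<^sup>2" "w e1 e2 = 2 * \<alpha> * \<beta>" "w e1 e3 = - (\<alpha> * \<beta>) / 4"
  "w e2 e1 = 2 * \<alpha> * \<beta>" "w e2 e2 = - 2 * \<alpha>\<^sup>2 - 3 / 2 * \<beta>\<^sup>2" "w e2 e3 = 3 / 2 * \<alpha>\<^sup>2"
  "w e3 e1 = - (\<alpha> * \<beta>) / 4" "w e3 e2 = 3 / 2 * \<alpha>\<^sup>2" "w e3 e3 = \<beta>\<^sup>2 / 2 - 2 * \<alpha>\<^sup>2"
  by (simp_all add: sym_wanas_form_def wanas_form_def wanas_tensor_def curvature_def Let_def
      nab0_simps torsion_simps g_simps power2_eq_square field_simps)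

abbreviation Wan :: "'a \<Rightarrow> 'a" where
  "Wan \<equiv> sym_wanas_operator br g J e1 e2 e3"

text \<open>Bilinearity of \<open>w\<close> gives the representing operator \<open>V\<close>, and
  nondegeneracy of \<open>g\<close> its uniqueness, so the definite description denotes
  \<open>V\<close>.\<close>

lemma g_Wan: "g (Wan x) y = w x y"
proof -
  define V where "V x = w x e1 *\<^sub>R e1 + w x e2 *\<^sub>R e2 - w x e3 *\<^sub>R e3" for x
  have V: "\<forall>x y. w x y = g (V x) y"
    using bilinear_w unfolding V_def by (simp add: linear_functional_represented bilinear_def)
  have "V' = V" if "\<forall>x y. w x y = g (V' x) y" for V'
    using V that by (intro ext g_nondegenerate) simp
  with V have "Wan = V"
    unfolding sym_wanas_operator_def by (rule the_equality)
  with V show ?thesis by simp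
qed

lemma Wan_frame: "Wan x = w x e1 *\<^sub>R e1 + w x e2 *\<^sub>R e2 - w x e3 *\<^sub>R e3"
  using frame_expansion[of "Wan x"] by (simp add: g_Wan)

section \<open>The derivation identity\<close>

lemma soliton_imp_alpha_eq_0:
  assumes "second_kind_algebraic_wanas_soliton br g J e1 e2 e3"
  shows "\<alpha> = 0"
proof (rule ccontr)
  assume \<alpha>: "\<alpha> \<noteq> 0"
  obtain c D where D: "derivation br D" and Wan_D: "\<And>x. Wan x = c *\<^sub>R x + D x"
    using assms by (auto simp: second_kind_algebraic_wanas_soliton_def)
  have linear_D: "linear D" and deriv: "\<And>x y. D (br x y) = br (D x) y + br x (D y)"
    using D by (auto simp: derivation_def)
  have D_eq: "D x = w x e1 *\<^sub>R e1 + w x e2 *\<^sub>R e2 - w x e3 *\<^sub>R e3 - c *\<^sub>R x" for x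
    using Wan_D[of x] by (simp add: Wan_frame algebra_simps)
  note s = D_eq br_simps g_simps w_table linear_add[OF linear_D] linear_diff[OF linear_D]
    linear_scale[OF linear_D] linear_neg[OF linear_D]
  \<comment> \<open>With \<open>D = Wan - c Id\<close> the identity reads
    \<open>Wan [x, y] + c [x, y] = [Wan x, y] + [x, Wan y]\<close>. Since \<open>[e1, e2]\<close>
    has no component along \<open>e2\<close>, \<open>c\<close> drops out here.\<close>
  have "g (D (br e1 e2)) e2 = g (br (D e1) e2 + br e1 (D e2)) e2"
    by (simp only: deriv)
  then have "\<alpha>\<^sup>2 * \<beta> = 0"
    by (simp add: s bilinear_simps[OF bilinear_w] power2_eq_square field_simps)
  with \<alpha> have \<beta>: "\<beta> = 0" by simp
  have "g (D (br e1 e2)) e1 = g (br (D e1) e2 + br e1 (D e2)) e1"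
    by (simp only: deriv)
  then have "\<alpha> * (c + \<alpha>\<^sup>2 / 2) = 0"
    using \<beta> by (simp add: s bilinear_simps[OF bilinear_w] power2_eq_square field_simps)
  with \<alpha> have c: "c = - \<alpha>\<^sup>2 / 2" by simp
  \<comment> \<open>For \<beta> = 0 this component alone would give
    \<open>c = \<alpha>\<^sup>2 / 2\<close>, the negative of the value just found.\<close>
  have "g (D (br e1 e3)) e1 = g (br (D e1) e3 + br e1 (D e3)) e1"
    by (simp only: deriv)
  then have "\<alpha> * \<alpha>\<^sup>2 = 0"
    using \<beta> c by (simp add: s bilinear_simps[OF bilinear_w] power2_eq_square field_simps)
  with \<alpha> show False by simp
qed

end

theorem theorem2p5:
  fixes \<alpha> \<beta> :: real
    and br :: "'a::real_vector \<Rightarrow> 'a \<Rightarrow> 'a"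
    and g :: "'a \<Rightarrow> 'a \<Rightarrow> real"
    and J :: "'a \<Rightarrow> 'a"
    and e1 e2 e3 :: 'a
  assumes "\<alpha> \<noteq> 0"
    and "lie_bracket br"
    and "symmetric_bilinear_form g"
    and "pseudo_orthonormal_basis g e1 e2 e3"
    and "br e1 e2 = \<alpha> *\<^sub>R e1 - \<beta> *\<^sub>R e3"
    and "br e1 e3 = - (\<alpha> *\<^sub>R e1) - \<beta> *\<^sub>R e2"
    and "br e2 e3 = \<beta> *\<^sub>R e1 + \<alpha> *\<^sub>R e2 + \<alpha> *\<^sub>R e3"
    and "linear J"
    and "J e1 = e1" and "J e2 = e2" and "J e3 = - e3"
  shows "\<not> second_kind_algebraic_wanas_soliton br g J e1 e2 e3"
proof -
  interpret wanas_G1 g e1 e2 e3 \<alpha> \<beta> br J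
    by (intro wanas_G1.intro lorentzian_frame.intro wanas_G1_axioms.intro assms)
  show ?thesis
    using soliton_imp_alpha_eq_0 assms(1) by blast
qed

end
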